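(* Let $r,R_1,R_2>0$ be real numbers with $R_1\ge r$ and $R_2\ge r$. Let $(h,C_1,C_2,\rho)$ be an initial configuration of the Model B puzzle in which the middle hoop $h$ has radius $r$ and the end circles $C_1,C_2$ have radii $R_1,R_2$, with rope $\rho$ from $p_1\in C_1$ to $p_2\in C_2$. Then the puzzle is impossible, even if arbitrary homotopies of the rope are allowed, the rope is allowed to cut the circles at its ends, and the two circles are allowed to cut each other, as long as the rope and the circles at its ends are forbidden to touch the middle hoop. That is, there do not exist continuous families $(f_t)_{t\in[0,1]}$, $(g^1_t)_{t\in[0,1]}$, $(g^2_t)_{t\in[0,1]}$ of orientation-preserving isometries of $\mathbb{R}^3$ with $f_0=g^1_0=g^2_0=\mathrm{id}$, and a continuous map $[0,1]\times[0,1]\to\mathbb{R}^3$, $(t,s)\mapsto\rho_t(s)$, with $\rho_0=\rho$, such that: (a) for every $t\in[0,1]$, $\rho_t(0)=g^1_t(p_1)$ and $\rho_t(1)=g^2_t(p_2)$; (b) for every $t\in[0,1]$, the moved hoop $f_t(h)$ is disjoint from $g^1_t(C_1)\cup g^2_t(C_2)\cup\rho_t([0,1])$; (c) at time $t=1$ the hoop has been removed, i.e. there is an affine plane in $\mathbb{R}^3$ such that $f_1(h)$ lies in one of its open sides and $g^1_1(C_1)\cup g^2_1(C_2)\cup\rho_1([0,1])$ lies in the other.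
   Context: The Model B puzzle consists of a rope that has a rigid round circle attached at each of its two ends, together with a rigid round hoop placed in between the two end circles, around the rope. The goal is to remove the middle hoop, i.e. to separate it from the rope and its end circles. Here "circle" and "hoop" mean round circles (curves, not disks) in $\mathbb{R}^3$. An initial configuration $(h,C_1,C_2,\rho)$ consists of a round circle $h$ of radius $r$ lying in an affine plane $P$; a round circle $C_1$ of radius $R_1$ contained in one of the two open half-spaces bounded by $P$; a round circle $C_2$ of radius $R_2$ contained in the other open half-space; and a continuous path $\rho:[0,1]\to\mathbb{R}^3$ with $\rho(0)=p_1\in C_1$ and $\rho(1)=p_2\in C_2$, which meets $P$ in exactly one parameter value, at a point of the open flat disk in $P$ bounded by $h$. *)

theory Defs
  imports "HOL-Analysis.Analysis"
begin

definition is_plane :: "(real^3) set \<Rightarrow> bool" where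
  "is_plane P \<longleftrightarrow> (\<exists>n d. n \<noteq> 0 \<and> P = {x. n \<bullet> x = d})"

definition opposite_sides :: "(real^3) set \<Rightarrow> (real^3) set \<Rightarrow> (real^3) set \<Rightarrow> bool" where
  \<comment> \<open>Replacing \<open>(n, d)\<close> by \<open>(-n, -d)\<close> swaps the two open half-spaces,
      so the order of \<open>A\<close> and \<open>B\<close> is immaterial.\<close>
  "opposite_sides P A B \<longleftrightarrow>
     (\<exists>n d. n \<noteq> 0 \<and> P = {x. n \<bullet> x = d} \<and> A \<subseteq> {x. n \<bullet> x < d} \<and> B \<subseteq> {x. n \<bullet> x > d})"

definition circle_in :: "(real^3) set \<Rightarrow> real^3 \<Rightarrow> real \<Rightarrow> (real^3) set \<Rightarrow> bool" where
  "circle_in P c r C \<longleftrightarrow> is_plane P \<and> c \<in> P \<and> r > 0 \<and> C = P \<inter> sphere c r"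

definition round_circle :: "real \<Rightarrow> (real^3) set \<Rightarrow> bool" where
  "round_circle r C \<longleftrightarrow> (\<exists>P c. circle_in P c r C)"

definition initial_configuration ::
  "real \<Rightarrow> real \<Rightarrow> real \<Rightarrow> (real^3) set \<Rightarrow> (real^3) set \<Rightarrow> (real^3) set \<Rightarrow> (real \<Rightarrow> real^3) \<Rightarrow> bool" where
  "initial_configuration r R1 R2 h C1 C2 \<rho> \<longleftrightarrow>
     round_circle R1 C1 \<and> round_circle R2 C2 \<and>
     path \<rho> \<and> pathstart \<rho> \<in> C1 \<and> pathfinish \<rho> \<in> C2 \<and>
     (\<exists>P c. circle_in P c r h \<and> opposite_sides P C1 C2 \<and>
        (\<exists>s\<in>{0..1}. {u \<in> {0..1}. \<rho> u \<in> P} = {s} \<and> \<rho> s \<in> P \<inter> ball c r))"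

definition orientation_preserving_isometry :: "(real^3 \<Rightarrow> real^3) \<Rightarrow> bool" where
  \<comment> \<open>Isometries of Euclidean space are affine; \<open>\<lambda>x. f x - f 0\<close> is the linear part.\<close>
  "orientation_preserving_isometry f \<longleftrightarrow>
     (\<forall>x y. dist (f x) (f y) = dist x y) \<and> det (matrix (\<lambda>x. f x - f 0)) > 0"

definition rigid_motion_family :: "(real \<Rightarrow> real^3 \<Rightarrow> real^3) \<Rightarrow> bool" where
  "rigid_motion_family f \<longleftrightarrow>
     (\<forall>t\<in>{0..1}. orientation_preserving_isometry (f t)) \<and>
     continuous_on ({0..1} \<times> UNIV) (\<lambda>(t, x). f t x) \<and>
     f 0 = id"

end

theory Submission
  imports Defs
begin

text \<open>Let the hoop at time \<open>t\<close> have centre \<open>c\<close>, radius \<open>r\<close> and normal \<open>n\<close>, and put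
  \<open>W\<^sub>t x = (|x - c|\<^sup>2 - r\<^sup>2) + \<i> n \<bullet> (x - c)\<close>, which vanishes exactly on the hoop. On an end
  circle of radius \<open>R \<ge> r\<close> the map \<open>W\<^sub>t\<close> traces an ellipse around a centre \<open>\<alpha>\<^sub>t\<close> with
  \<open>Re \<alpha>\<^sub>t \<ge> 0\<close>. The ellipse never meets \<open>0\<close> and initially does not enclose it, so the filled
  ellipse avoids \<open>0\<close> at all times. Hence the closed curve that runs from \<open>1\<close> to the centre of the
  first ellipse, straight on to \<open>W\<^sub>t p\<^sub>1\<close>, along the image of the rope to \<open>W\<^sub>t p\<^sub>2\<close>, straight to
  the centre of the second ellipse, and back to \<open>1\<close> has constant winding number around \<open>0\<close>.
  It is \<open>\<plusminus>1\<close> initially, because the rope crosses the flat disc once, and \<open>0\<close> once the hoop has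
  been separated, because then the curve avoids the negative real axis.\<close>

section \<open>Continuous logarithms along intervals\<close>

text \<open>Two logarithms of \<open>c\<close> differ by an integer multiple of
  \<open>2 * pi * \<i>\<close>, so \<open>g\<close> has discrete range, and on a connected set
  continuity makes it constant.\<close>

lemma continuous_exp_constant:
  fixes g :: "'a::topological_space \<Rightarrow> complex"
  assumes "connected S" and cont: "continuous_on S g"
    and ex: "\<And>x. x \<in> S \<Longrightarrow> exp (g x) = c"
    and "a \<in> S" "b \<in> S"
  shows "g a = g b"
proof -
  have "g constant_on S"
  proof (rule continuous_discrete_range_constant [OF \<open>connected S\<close> cont])
    fix x assume x: "x \<in> S"
    have "2 * pi \<le> norm (g y - g x)" if y: "y \<in> S" "g y \<noteq> g x" for y
    proof -
      from ex x y have "exp (g y) = exp (g x)" by simp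
      then obtain n :: int where n: "g y = g x + (of_int (2 * n) * pi) * \<i>"
        using exp_eq by blast
      with y have "n \<noteq> 0" by auto
      then have "1 \<le> \<bar>real_of_int n\<bar>" by linarith
      then show ?thesis
        by (simp add: n norm_mult)
    qed
    then show "\<exists>e>0. \<forall>y. y \<in> S \<and> g y \<noteq> g x \<longrightarrow> e \<le> norm (g y - g x)"
      by (intro exI [of _ "2 * pi"]) auto
  qed
  then show ?thesis
    using assms by (metis constant_on_def)
qed

text \<open>The difference \<open>g s - Ln (k * exp (g s))\<close> is a continuous logarithm of
  \<open>1 / k\<close>, hence constant. The factor \<open>k\<close> rotates the curve away from the
  branch cut.\<close>

lemma log_increment_Ln:
  fixes g :: "real \<Rightarrow> complex"
  assumes "a \<le> b" and "continuous_on {a..b} g"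
    and slit: "\<And>s. s \<in> {a..b} \<Longrightarrow> k * exp (g s) \<notin> \<real>\<^sub>\<le>\<^sub>0"
  shows "g b - g a = Ln (k * exp (g b)) - Ln (k * exp (g a))"
proof -
  have k: "k \<noteq> 0"
    using slit [of a] \<open>a \<le> b\<close> by auto
  have "g a - Ln (k * exp (g a)) = g b - Ln (k * exp (g b))"
  proof (rule continuous_exp_constant [where g = "\<lambda>s. g s - Ln (k * exp (g s))" and S = "{a..b}" and c = "1 / k"])
    show "continuous_on {a..b} (\<lambda>s. g s - Ln (k * exp (g s)))"
      by (intro continuous_intros assms)
    show "exp (g s - Ln (k * exp (g s))) = 1 / k" if "s \<in> {a..b}" for s
      using k by (simp add: exp_diff)
  qed (use \<open>a \<le> b\<close> in auto)
  then show ?thesis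
    by (simp add: algebra_simps)
qed

text \<open>Passing from the upper to the lower half-plane through the negative real axis, a
  continuous logarithm gains \<open>2 * pi\<close> over the principal one. Splitting at
  \<open>s\<close> lets each half use its own rotation.\<close>

lemma log_increment_crossing:
  fixes g :: "real \<Rightarrow> complex"
  assumes cont: "continuous_on {0..1} g" and s: "s \<in> {0..1}"
    and up: "\<And>u. 0 \<le> u \<Longrightarrow> u < s \<Longrightarrow> Im (exp (g u)) > 0"
    and down: "\<And>u. s < u \<Longrightarrow> u \<le> 1 \<Longrightarrow> Im (exp (g u)) < 0"
    and neg: "Im (exp (g s)) = 0" "Re (exp (g s)) < 0"
    and ends: "Im (exp (g 0)) > 0" "Im (exp (g 1)) < 0"
  shows "Im (g 1 - g 0) = 2 * pi + (Im (Ln (exp (g 1))) - Im (Ln (exp (g 0))))"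
proof -
  \<comment> \<open>Multiplication by \<open>- \<i>\<close> sends the upper half-plane to the right
    half-plane and the crossing point to the positive imaginary axis. On the second half
    \<open>\<i>\<close> does this for the lower half-plane, with the crossing point going to the
    negative imaginary axis.\<close>
  have L1: "g s - g 0 = Ln (- \<i> * exp (g s)) - Ln (- \<i> * exp (g 0))"
  proof (rule log_increment_Ln)
    show "- \<i> * exp (g u) \<notin> \<real>\<^sub>\<le>\<^sub>0" if "u \<in> {0..s}" for u
      using up [of u] neg that by (cases "u = s") (auto simp: complex_nonpos_Reals_iff)
  qed (use s in \<open>auto intro: continuous_on_subset [OF cont]\<close>)
  have L2: "g 1 - g s = Ln (\<i> * exp (g 1)) - Ln (\<i> * exp (g s))"
  proof (rule log_increment_Ln)
    show "\<i> * exp (g u) \<notin> \<real>\<^sub>\<le>\<^sub>0" if "u \<in> {s..1}" for u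
      using down [of u] neg that by (cases "u = s") (auto simp: complex_nonpos_Reals_iff)
  qed (use s in \<open>auto intro: continuous_on_subset [OF cont]\<close>)
  have e: "exp (g u) \<noteq> 0" for u by simp
  \<comment> \<open>The rotated arguments at the crossing are \<open>pi / 2\<close> and
    \<open>- pi / 2\<close>; undoing the rotations at the two ends adds \<open>pi / 2\<close>
    each.\<close>
  have "Im (Ln (- \<i> * exp (g s))) - Im (Ln (\<i> * exp (g s))) = pi"
    using neg e by (simp add: Ln_minus)
  moreover have "Im (Ln (\<i> * exp (g 1))) = Im (Ln (exp (g 1))) + pi / 2"
    using ends e by (simp add: Ln_times_ii)
  moreover have "Im (Ln (- \<i> * exp (g 0))) = Im (Ln (exp (g 0))) - pi / 2"
    using ends e by (auto simp: Ln_minus Ln_times_ii)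
  ultimately show ?thesis
    using arg_cong [OF L1, of Im] arg_cong [OF L2, of Im] by simp
qed

section \<open>Filled ellipses in the complex plane\<close>

text \<open>Intermediate values of the norm along a line, between \<open>z\<close> and its shift by
  a vector of norm 2. With \<open>k\<close> in the kernel of a linear map, it carries a zero of an
  affine map to the unit circle.\<close>

lemma disc_line_meets_circle:
  fixes z k :: "'a::real_normed_vector"
  assumes "norm z \<le> 1" and "k \<noteq> 0"
  obtains \<mu> :: real where "norm (z + \<mu> *\<^sub>R k) = 1"
proof -
  have "norm ((2 / norm k) *\<^sub>R k) = 2" using \<open>k \<noteq> 0\<close> by simp
  then have "1 \<le> norm (z + (2 / norm k) *\<^sub>R k)"
    using assms(1) norm_triangle_ineq4 [of "z + (2 / norm k) *\<^sub>R k" z] by simp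
  then have "\<exists>\<mu>\<ge>0. \<mu> \<le> 2 / norm k \<and> norm (z + \<mu> *\<^sub>R k) = 1"
    using assms(1) by (intro IVT') (auto intro!: continuous_intros)
  with that show thesis by blast
qed

definition ellipse :: "complex \<Rightarrow> complex \<Rightarrow> complex \<Rightarrow> complex \<Rightarrow> complex" where
  "ellipse \<alpha> \<beta> \<gamma> z = \<alpha> + Re z *\<^sub>R \<beta> + Im z *\<^sub>R \<gamma>"

text \<open>The determinant of two complex numbers read as vectors of the real plane.\<close>

definition cdet :: "complex \<Rightarrow> complex \<Rightarrow> real" where
  "cdet u v = Re u * Im v - Im u * Re v"

text \<open>Cramer's rule: up to sign, the coordinates of the zero are the two determinants on the
  left over \<open>cdet \<beta> \<gamma>\<close>, and the inequality places it in the open unit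
  disc. Being strict, it is an open condition on the coefficients.\<close>

lemma ellipse_encloses_zero_iff:
  assumes nz: "\<And>z. norm z = 1 \<Longrightarrow> ellipse \<alpha> \<beta> \<gamma> z \<noteq> 0"
  shows "(\<exists>z. norm z \<le> 1 \<and> ellipse \<alpha> \<beta> \<gamma> z = 0) \<longleftrightarrow>
    (cdet \<alpha> \<gamma>)\<^sup>2 + (cdet \<beta> \<alpha>)\<^sup>2 < (cdet \<beta> \<gamma>)\<^sup>2"
proof
  assume "\<exists>z. norm z \<le> 1 \<and> ellipse \<alpha> \<beta> \<gamma> z = 0"
  then obtain z where z: "norm z \<le> 1" "ellipse \<alpha> \<beta> \<gamma> z = 0" by blast
  \<comment> \<open>If the determinant vanished, the linear part would kill some \<open>k\<close>,
    and sliding the zero along \<open>k\<close> to the unit circle would contradict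
    \<open>nz\<close>.\<close>
  have d: "cdet \<beta> \<gamma> \<noteq> 0"
  proof
    assume d: "cdet \<beta> \<gamma> = 0"
    have "\<exists>k. k \<noteq> 0 \<and> Re k *\<^sub>R \<beta> + Im k *\<^sub>R \<gamma> = 0"
    proof -
      \<comment> \<open>Each of the first two candidates annihilates one row of the matrix by
        construction and the other because the determinant is zero.\<close>
      consider "Complex (Re \<gamma>) (- Re \<beta>) \<noteq> 0" | "Complex (Im \<gamma>) (- Im \<beta>) \<noteq> 0" | "\<beta> = 0 \<and> \<gamma> = 0"
        by (auto simp: complex_eq_iff)
      then show ?thesis
      proof cases
        case 1
        then show ?thesis
          using d by (intro exI [of _ "Complex (Re \<gamma>) (- Re \<beta>)"]) (auto simp: cdet_def complex_eq_iff algebra_simps)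
      next
        case 2
        then show ?thesis
          using d by (intro exI [of _ "Complex (Im \<gamma>) (- Im \<beta>)"]) (auto simp: cdet_def complex_eq_iff algebra_simps)
      next
        case 3
        then show ?thesis by (intro exI [of _ 1]) auto
      qed
    qed
    then obtain k where k: "k \<noteq> 0" "Re k *\<^sub>R \<beta> + Im k *\<^sub>R \<gamma> = 0" by blast
    obtain \<mu> where \<mu>: "norm (z + \<mu> *\<^sub>R k) = 1"
      using disc_line_meets_circle z k by blast
    have "ellipse \<alpha> \<beta> \<gamma> (z + \<mu> *\<^sub>R k) = ellipse \<alpha> \<beta> \<gamma> z + \<mu> *\<^sub>R (Re k *\<^sub>R \<beta> + Im k *\<^sub>R \<gamma>)"
      by (simp add: ellipse_def algebra_simps)
    with z k nz [OF \<mu>] show False by simp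
  qed
  have "norm z \<noteq> 1" using nz z by auto
  with z have "norm z < 1" by linarith
  then have "(norm z)\<^sup>2 < 1" by (simp add: power_less_one_iff)
  then have "(Re z)\<^sup>2 + (Im z)\<^sup>2 < 1" by (simp add: cmod_power2)
  with d have "((Re z)\<^sup>2 + (Im z)\<^sup>2) * (cdet \<beta> \<gamma>)\<^sup>2 < (cdet \<beta> \<gamma>)\<^sup>2" by simp
  moreover have \<alpha>: "Re \<alpha> = - (Re z * Re \<beta> + Im z * Re \<gamma>)" "Im \<alpha> = - (Re z * Im \<beta> + Im z * Im \<gamma>)"
    using z by (auto simp: ellipse_def complex_eq_iff)
  then have "cdet \<alpha> \<gamma> = - Re z * cdet \<beta> \<gamma>" "cdet \<beta> \<alpha> = - Im z * cdet \<beta> \<gamma>"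
    unfolding cdet_def \<alpha> by (simp_all add: algebra_simps)
  ultimately show "(cdet \<alpha> \<gamma>)\<^sup>2 + (cdet \<beta> \<alpha>)\<^sup>2 < (cdet \<beta> \<gamma>)\<^sup>2"
    by (simp add: power_mult_distrib algebra_simps)
next
  assume q: "(cdet \<alpha> \<gamma>)\<^sup>2 + (cdet \<beta> \<alpha>)\<^sup>2 < (cdet \<beta> \<gamma>)\<^sup>2"
  then have d: "cdet \<beta> \<gamma> \<noteq> 0"
    using not_sum_power2_lt_zero [of "cdet \<alpha> \<gamma>" "cdet \<beta> \<alpha>"] by auto
  define z where "z = Complex (- cdet \<alpha> \<gamma> / cdet \<beta> \<gamma>) (- cdet \<beta> \<alpha> / cdet \<beta> \<gamma>)"
  have "(norm z)\<^sup>2 = ((cdet \<alpha> \<gamma>)\<^sup>2 + (cdet \<beta> \<alpha>)\<^sup>2) / (cdet \<beta> \<gamma>)\<^sup>2"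
    by (simp add: cmod_power2 z_def power_divide add_divide_distrib)
  also have "\<dots> \<le> 1\<^sup>2" using q d by simp
  finally have "norm z \<le> 1" by (rule power2_le_imp_le) simp
  moreover have "cdet \<beta> \<gamma> *\<^sub>R ellipse \<alpha> \<beta> \<gamma> z = cdet \<beta> \<gamma> *\<^sub>R \<alpha> - cdet \<alpha> \<gamma> *\<^sub>R \<beta> - cdet \<beta> \<alpha> *\<^sub>R \<gamma>"
    using d by (simp add: ellipse_def z_def algebra_simps)
  \<comment> \<open>The linear relation among three vectors of the plane, with determinants as
    coefficients.\<close>
  moreover have "\<dots> = 0"
    by (simp add: complex_eq_iff cdet_def algebra_simps)
  ultimately show "\<exists>z. norm z \<le> 1 \<and> ellipse \<alpha> \<beta> \<gamma> z = 0"
    using d by auto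
qed

text \<open>The times at which the filled ellipse contains \<open>0\<close> form a closed set by compactness, and
  an open one by the determinant criterion above.\<close>

lemma filled_ellipse_avoids_zero:
  assumes cont: "continuous_on {0..1} \<alpha>" "continuous_on {0..1} \<beta>" "continuous_on {0..1} \<gamma>"
    and nz: "\<And>t z. t \<in> {0..1::real} \<Longrightarrow> norm z = 1 \<Longrightarrow> ellipse (\<alpha> t) (\<beta> t) (\<gamma> t) z \<noteq> 0"
    and init: "\<And>z. norm z = 1 \<Longrightarrow> Im (ellipse (\<alpha> 0) (\<beta> 0) (\<gamma> 0) z) \<noteq> 0"
    and t: "t \<in> {0..1}" and z: "norm z \<le> 1"
  shows "ellipse (\<alpha> t) (\<beta> t) (\<gamma> t) z \<noteq> 0"
proof -
  define F where "F = (\<lambda>(t, z). ellipse (\<alpha> t) (\<beta> t) (\<gamma> t) z)"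
  define S where "S = ({0..1} \<times> cball 0 1) \<inter> F -` {0}"
  define q where "q = (\<lambda>t. (cdet (\<alpha> t) (\<gamma> t))\<^sup>2 + (cdet (\<beta> t) (\<alpha> t))\<^sup>2 - (cdet (\<beta> t) (\<gamma> t))\<^sup>2)"
  define T where "T = fst ` S"
  have T: "t \<in> T \<longleftrightarrow> t \<in> {0..1} \<and> (\<exists>z. norm z \<le> 1 \<and> ellipse (\<alpha> t) (\<beta> t) (\<gamma> t) z = 0)" for t
    by (force simp: T_def S_def F_def)
  have cont': "continuous_on ({0..1} \<times> X) (\<lambda>x. f (fst x))"
    if "continuous_on {0..1} f" for f :: "real \<Rightarrow> complex" and X :: "complex set"
    by (rule continuous_on_compose2 [OF that]) (auto intro: continuous_intros)
  have "continuous_on ({0..1} \<times> cball 0 1) F"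
    unfolding F_def ellipse_def case_prod_beta
    by (intro continuous_intros cont' cont)
  then have "closed S"
    unfolding S_def by (intro continuous_closed_preimage) (auto intro: closed_Times)
  moreover have "bounded S"
    unfolding S_def by (rule bounded_subset [of "{0..1} \<times> cball 0 1"]) (auto intro: bounded_Times)
  ultimately have "compact T"
    unfolding T_def by (intro compact_continuous_image continuous_intros) (simp add: compact_eq_bounded_closed)
  then have cl: "closedin (top_of_set {0..1}) T"
    using T by (intro closed_subset compact_imp_closed) auto
  have "T = {0..1} \<inter> q -` {..<0}"
  proof -
    have "t \<in> T \<longleftrightarrow> q t < 0" if "t \<in> {0..1}" for t
      using ellipse_encloses_zero_iff [OF nz [OF that]] that by (simp add: T q_def)
    moreover have "T \<subseteq> {0..1}" using T by blast
    ultimately show ?thesis by blast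
  qed
  moreover have "continuous_on {0..1} q"
    unfolding q_def cdet_def by (intro continuous_intros cont)
  ultimately have op: "openin (top_of_set {0..1}) T"
    by (simp add: continuous_openin_preimage_gen)
  have "0 \<notin> T"
  proof
    assume "0 \<in> T"
    then obtain z where z: "norm z \<le> 1" "ellipse (\<alpha> 0) (\<beta> 0) (\<gamma> 0) z = 0" using T by blast
    \<comment> \<open>A direction along which the imaginary part at time \<open>0\<close> is
      constant: a zero in the disc would slide along it to a point of the circle with imaginary part
      \<open>0\<close>, against \<open>init\<close>.\<close>
    define k where "k = (if Im (\<beta> 0) = 0 then 1 else Complex (Im (\<gamma> 0)) (- Im (\<beta> 0)))"
    have k: "k \<noteq> 0" "Re k * Im (\<beta> 0) + Im k * Im (\<gamma> 0) = 0"
      by (auto simp: k_def complex_eq_iff)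
    obtain \<mu> where \<mu>: "norm (z + \<mu> *\<^sub>R k) = 1"
      using disc_line_meets_circle z k by blast
    have "Im (ellipse (\<alpha> 0) (\<beta> 0) (\<gamma> 0) (z + \<mu> *\<^sub>R k)) =
        Im (ellipse (\<alpha> 0) (\<beta> 0) (\<gamma> 0) z) + \<mu> * (Re k * Im (\<beta> 0) + Im k * Im (\<gamma> 0))"
      by (simp add: ellipse_def algebra_simps)
    with z k init [OF \<mu>] show False by simp
  qed
  moreover have "connected {0..1::real}" by simp
  ultimately have "T = {}"
    using cl op unfolding connected_clopen by auto
  then show ?thesis using T t z by blast
qed

section \<open>Transported logarithms and the homotopy invariant\<close>

text \<open>The logarithm of \<open>w\<close> obtained by transporting the principal logarithm of \<open>\<alpha>\<close> along the
  segment from \<open>\<alpha> t\<close> to \<open>w t\<close>.\<close>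

lemma logarithm_along_segment:
  fixes \<alpha> w :: "real \<Rightarrow> complex"
  assumes cont: "continuous_on {0..1} \<alpha>" "continuous_on {0..1} w"
    and slit: "\<And>t. t \<in> {0..1} \<Longrightarrow> \<alpha> t \<notin> \<real>\<^sub>\<le>\<^sub>0"
    and seg: "\<And>t l. t \<in> {0..1} \<Longrightarrow> l \<in> {0..1} \<Longrightarrow> \<alpha> t + l *\<^sub>R (w t - \<alpha> t) \<noteq> 0"
  obtains L where "continuous_on {0..1} L" "\<And>t. t \<in> {0..1} \<Longrightarrow> exp (L t) = w t"
    "\<And>t. t \<in> {0..1} \<Longrightarrow> (\<And>l. l \<in> {0..1} \<Longrightarrow> \<alpha> t + l *\<^sub>R (w t - \<alpha> t) \<notin> \<real>\<^sub>\<le>\<^sub>0) \<Longrightarrow> L t = Ln (w t)"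
proof -
  define F where "F = (\<lambda>(t, l). \<alpha> t + l *\<^sub>R (w t - \<alpha> t))"
  have cont': "continuous_on ({0..1} \<times> {0..1::real}) (\<lambda>x. f (fst x))"
    if "continuous_on {0..1} f" for f :: "real \<Rightarrow> complex"
    by (rule continuous_on_compose2 [OF that]) (auto intro: continuous_on_fst continuous_on_id)
  have contF: "continuous_on ({0..1} \<times> {0..1}) F"
    unfolding F_def case_prod_beta by (intro continuous_intros cont' cont)
  have "contractible ({0..1} \<times> {0..1::real} :: (real \<times> real) set)"
    by (intro convex_imp_contractible convex_Times) auto
  moreover have "F x \<noteq> 0" if "x \<in> {0..1} \<times> {0..1}" for x
    using that seg by (auto simp: F_def)
  ultimately obtain g where g: "continuous_on ({0..1} \<times> {0..1}) g"
    and gF: "\<And>x. x \<in> {0..1} \<times> {0..1} \<Longrightarrow> F x = exp (g x)"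
    using continuous_logarithm_on_contractible [OF contF] by metis
  have slice: "continuous_on {0..1} (\<lambda>t. g (t, l))" if "l \<in> {0..1}" for l
    by (rule continuous_on_compose2 [OF g]) (use that in \<open>auto intro!: continuous_intros\<close>)
  have slice': "continuous_on {0..1} (\<lambda>l. g (t, l))" if "t \<in> {0..1}" for t
    by (rule continuous_on_compose2 [OF g]) (use that in \<open>auto intro!: continuous_intros\<close>)
  \<comment> \<open>Only the increment of \<open>g\<close> along the segment enters, so
    \<open>L\<close> does not depend on the additive constant in \<open>g\<close>.\<close>
  define L where "L = (\<lambda>t. Ln (\<alpha> t) + g (t, 1) - g (t, 0))"
  have e0: "exp (g (t, 0)) = \<alpha> t" and e1: "exp (g (t, 1)) = w t" if "t \<in> {0..1}" for t
    using gF [of "(t, 0)"] gF [of "(t, 1)"] that by (auto simp: F_def)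
  show thesis
  proof
    show "continuous_on {0..1} L"
      unfolding L_def by (intro continuous_intros slice cont slit) auto
    show "exp (L t) = w t" if "t \<in> {0..1}" for t
    proof -
      have "\<alpha> t \<noteq> 0" using slit [OF that] by auto
      then show ?thesis
        using e0 [OF that] e1 [OF that] by (simp add: L_def exp_add exp_diff)
    qed
    show "L t = Ln (w t)" if t: "t \<in> {0..1}"
      and sl: "\<And>l. l \<in> {0..1} \<Longrightarrow> \<alpha> t + l *\<^sub>R (w t - \<alpha> t) \<notin> \<real>\<^sub>\<le>\<^sub>0" for t
    proof -
      have "1 * exp (g (t, l)) \<notin> \<real>\<^sub>\<le>\<^sub>0" if "l \<in> {0..1}" for l
        using gF [of "(t, l)"] t that sl [OF that] by (auto simp: F_def)
      then have "g (t, 1) - g (t, 0) = Ln (1 * exp (g (t, 1))) - Ln (1 * exp (g (t, 0)))"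
        by (intro log_increment_Ln slice' t) auto
      then show ?thesis
        using e0 [OF t] e1 [OF t] by (simp add: L_def algebra_simps)
    qed
  qed
qed

text \<open>The increment of a logarithm of \<open>w t\<close> along the rope, minus
  \<open>L2 t - L1 t\<close>, is an integer multiple of \<open>2 * pi * \<i>\<close> and so constant
  in \<open>t\<close>. The crossing at time \<open>0\<close> gives it imaginary part
  \<open>2 * pi\<close>, while \<open>slit\<close> makes it \<open>0\<close> at time
  \<open>1\<close>.\<close>

lemma no_homotopy_across_cut:
  fixes w :: "real \<Rightarrow> real \<Rightarrow> complex" and L1 L2 :: "real \<Rightarrow> complex"
  assumes contw: "continuous_on ({0..1} \<times> {0..1}) (\<lambda>(t, s). w t s)"
    and nz: "\<And>t s. t \<in> {0..1} \<Longrightarrow> s \<in> {0..1} \<Longrightarrow> w t s \<noteq> 0"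
    and contL: "continuous_on {0..1} L1" "continuous_on {0..1} L2"
    and L1: "\<And>t. t \<in> {0..1} \<Longrightarrow> exp (L1 t) = w t 0"
    and L2: "\<And>t. t \<in> {0..1} \<Longrightarrow> exp (L2 t) = w t 1"
    and start: "L1 0 = Ln (w 0 0)" "L2 0 = Ln (w 0 1)"
    and finish: "L1 1 = Ln (w 1 0)" "L2 1 = Ln (w 1 1)"
    and slit: "\<And>s. s \<in> {0..1} \<Longrightarrow> w 1 s \<notin> \<real>\<^sub>\<le>\<^sub>0"
    and s: "s \<in> {0..1}"
    and up: "\<And>u. 0 \<le> u \<Longrightarrow> u < s \<Longrightarrow> Im (w 0 u) > 0"
    and down: "\<And>u. s < u \<Longrightarrow> u \<le> 1 \<Longrightarrow> Im (w 0 u) < 0"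
    and neg: "Im (w 0 s) = 0" "Re (w 0 s) < 0"
    and ends: "Im (w 0 0) > 0" "Im (w 0 1) < 0"
  shows False
proof -
  have "contractible ({0..1} \<times> {0..1::real} :: (real \<times> real) set)"
    by (intro convex_imp_contractible convex_Times) auto
  moreover have "(\<lambda>(t, s). w t s) x \<noteq> 0" if "x \<in> {0..1} \<times> {0..1}" for x
    using that nz by auto
  ultimately obtain g where g: "continuous_on ({0..1} \<times> {0..1}) g"
    and gw: "\<And>x. x \<in> {0..1} \<times> {0..1} \<Longrightarrow> (\<lambda>(t, s). w t s) x = exp (g x)"
    using continuous_logarithm_on_contractible [OF contw] by metis
  have e: "exp (g (t, u)) = w t u" if "t \<in> {0..1}" "u \<in> {0..1}" for t u
    using gw [of "(t, u)"] that by auto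
  have slice: "continuous_on {0..1} (\<lambda>t. g (t, l))" if "l \<in> {0..1}" for l
    by (rule continuous_on_compose2 [OF g]) (use that in \<open>auto intro!: continuous_intros\<close>)
  have slice': "continuous_on {0..1} (\<lambda>l. g (t, l))" if "t \<in> {0..1}" for t
    by (rule continuous_on_compose2 [OF g]) (use that in \<open>auto intro!: continuous_intros\<close>)
  define D where "D = (\<lambda>t. (g (t, 1) - L2 t) - (g (t, 0) - L1 t))"
  have "D 0 = D 1"
  proof (rule continuous_exp_constant [where g = D and S = "{0..1}" and c = 1])
    show "continuous_on {0..1} D"
      unfolding D_def by (intro continuous_intros slice contL) auto
    show "exp (D t) = 1" if "t \<in> {0..1}" for t
      using that nz [OF that, of 0] nz [OF that, of 1] by (simp add: D_def exp_diff e L1 L2)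
  qed auto
  moreover have "D 1 = 0"
  proof -
    have "g (1, 1) - g (1, 0) = Ln (1 * exp (g (1, 1))) - Ln (1 * exp (g (1, 0)))"
      by (intro log_increment_Ln slice') (use slit e in auto)
    then show ?thesis by (simp add: D_def e finish algebra_simps)
  qed
  moreover have "Im (D 0) = 2 * pi"
  proof -
    have "Im (g (0, 1) - g (0, 0)) = 2 * pi + (Im (Ln (exp (g (0, 1)))) - Im (Ln (exp (g (0, 0)))))"
    proof (rule log_increment_crossing [OF slice' s])
      show "Im (exp (g (0, u))) > 0" if "0 \<le> u" "u < s" for u
        using up [OF that] s that by (simp add: e)
      show "Im (exp (g (0, u))) < 0" if "s < u" "u \<le> 1" for u
        using down [OF that] s that by (simp add: e)
    qed (use s neg ends e in auto)
    then show ?thesis by (simp add: D_def e start)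
  qed
  ultimately show False by simp
qed

section \<open>The hoop map along a moving end circle\<close>

text \<open>This function vanishes exactly on the circle with centre \<open>c\<close>, radius \<open>r\<close> and axis \<open>n\<close>,
  and takes values in \<open>\<real>\<^sub>\<le>\<^sub>0\<close> exactly on the closed flat disc it bounds.\<close>

definition hoop_map :: "real^3 \<Rightarrow> real^3 \<Rightarrow> real \<Rightarrow> real^3 \<Rightarrow> complex" where
  "hoop_map c n r x = Complex ((norm (x - c))\<^sup>2 - r\<^sup>2) (n \<bullet> (x - c))"

lemma continuous_on_hoop_map [continuous_intros]:
  assumes "continuous_on S c" "continuous_on S n" "continuous_on S x"
  shows "continuous_on S (\<lambda>u. hoop_map (c u) (n u) r (x u))"
  unfolding hoop_map_def Complex_eq by (intro continuous_intros assms)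

lemma nonpos_Reals_add_of_real:
  assumes "z \<notin> \<real>\<^sub>\<le>\<^sub>0" and "s \<ge> 0"
  shows "z + complex_of_real s \<notin> \<real>\<^sub>\<le>\<^sub>0"
  using assms by (auto simp: complex_nonpos_Reals_iff)

text \<open>After subtracting its value at \<open>0\<close>, a distance-preserving map is
  orthogonal, hence linear.\<close>

lemma isometry_affine:
  fixes f :: "'a::real_inner \<Rightarrow> 'a"
  assumes "\<And>x y. dist (f x) (f y) = dist x y"
  obtains A where "orthogonal_transformation A" "\<And>x y. f (x + y) = f x + A y"
proof -
  define A where "A = (\<lambda>y. f y - f 0)"
  have A: "orthogonal_transformation A"
    unfolding orthogonal_transformation_isometry
    by (simp add: A_def assms dist_norm) (simp flip: dist_norm add: assms)
  then have "A (x + y) = A x + A y" for x y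
    by (simp add: linear_add orthogonal_transformation_linear)
  then have "f (x + y) = f x + A y" for x y
    by (simp add: A_def algebra_simps)
  with A that show thesis by blast
qed

lemma rigid_motion_familyD:
  assumes "rigid_motion_family g"
  shows "g 0 = id"
    and "t \<in> {0..1} \<Longrightarrow> dist (g t x) (g t y) = dist x y"
    and "continuous_on {0..1} (\<lambda>t. g t x)"
proof -
  show "g 0 = id" and "t \<in> {0..1} \<Longrightarrow> dist (g t x) (g t y) = dist x y"
    using assms by (auto simp: rigid_motion_family_def orientation_preserving_isometry_def)
  have "continuous_on ({0..1} \<times> UNIV) (\<lambda>(t, x). g t x)"
    using assms by (auto simp: rigid_motion_family_def)
  then have "continuous_on {0..1} (\<lambda>t. (\<lambda>(t, x). g t x) (t, x))"
    by (rule continuous_on_compose2) (auto intro!: continuous_intros)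
  then show "continuous_on {0..1} (\<lambda>t. g t x)" by simp
qed

text \<open>The cross product of the plane's normal with \<open>p - m\<close>, divided by the length
  of the normal, is a second radius orthogonal to the first. The parameter \<open>z = 1\<close>
  gives \<open>p\<close>.\<close>

lemma circle_in_conjugate_radius:
  assumes "circle_in Q m R C" and "p \<in> C"
  obtains e' where "norm (p - m) = R" "norm e' = R" "(p - m) \<bullet> e' = 0"
    "\<And>z. norm z = 1 \<Longrightarrow> m + Re z *\<^sub>R (p - m) + Im z *\<^sub>R e' \<in> C"
proof -
  obtain n d where n: "n \<noteq> 0" and Q: "Q = {x. n \<bullet> x = d}" and m: "m \<in> Q"
    and R: "R > 0" and C: "C = Q \<inter> sphere m R"
    using assms(1) unfolding circle_in_def is_plane_def by auto
  define e where "e = p - m"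
  define e' where "e' = (1 / norm n) *\<^sub>R cross3 n e"
  have ne: "norm e = R" using assms(2) C by (auto simp: e_def dist_norm norm_minus_commute)
  have o: "n \<bullet> e = 0" using assms(2) m by (auto simp: C Q e_def inner_diff_right)
  have "(norm (cross3 n e))\<^sup>2 = (norm n * R)\<^sup>2"
    by (simp add: norm_cross o ne power_mult_distrib)
  then have "norm (cross3 n e) = norm n * R"
    using R by (simp add: power2_eq_iff_nonneg)
  then have ne': "norm e' = R" using n by (simp add: e'_def)
  have ee': "e \<bullet> e' = 0" "n \<bullet> e' = 0" by (simp_all add: e'_def dot_cross_self)
  have "m + Re z *\<^sub>R e + Im z *\<^sub>R e' \<in> C" if "norm z = 1" for z
  proof -
    have "orthogonal (Re z *\<^sub>R e) (Im z *\<^sub>R e')"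
      using ee' by (simp add: orthogonal_def)
    then have "(norm (Re z *\<^sub>R e + Im z *\<^sub>R e'))\<^sup>2 = R\<^sup>2 * ((Re z)\<^sup>2 + (Im z)\<^sup>2)"
      by (simp add: norm_add_Pythagorean ne ne' power_mult_distrib distrib_left mult.commute)
    also have "\<dots> = R\<^sup>2" using that by (simp flip: cmod_power2)
    finally have "norm (Re z *\<^sub>R e + Im z *\<^sub>R e') = R"
      using R by (simp add: power2_eq_iff_nonneg)
    then have "dist m (m + Re z *\<^sub>R e + Im z *\<^sub>R e') = R"
      by (metis add.assoc add_diff_cancel_left' dist_commute dist_norm)
    then show ?thesis
      using m o ee' by (simp add: C Q inner_add_right)
  qed
  with that [of e'] ne ne' ee' show thesis unfolding e_def by blast
qed

text \<open>Along a circle of radius \<open>R\<close>, the map is an ellipse whose centre has nonnegative real part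
  because \<open>R \<ge> r\<close>; hence the principal logarithm of the centre is continuous in time.\<close>

lemma hoop_map_circle_logarithm:
  assumes C: "circle_in Q m R C" and p: "p \<in> C" and r: "0 \<le> r" "r \<le> R"
    and g: "rigid_motion_family g"
    and cont: "continuous_on {0..1} c" "continuous_on {0..1} n"
    and nz: "\<And>t x. t \<in> {0..1} \<Longrightarrow> x \<in> g t ` C \<Longrightarrow> hoop_map (c t) (n t) r x \<noteq> 0"
    and init: "\<And>x. x \<in> C \<Longrightarrow> Im (hoop_map (c 0) (n 0) r x) \<noteq> 0"
  obtains L where "continuous_on {0..1} L"
    "\<And>t. t \<in> {0..1} \<Longrightarrow> exp (L t) = hoop_map (c t) (n t) r (g t p)"
    "\<And>t. t \<in> {0..1} \<Longrightarrow> (\<And>y. y \<in> convex hull (g t ` C) \<Longrightarrow> hoop_map (c t) (n t) r y \<notin> \<real>\<^sub>\<le>\<^sub>0) \<Longrightarrow>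
       L t = Ln (hoop_map (c t) (n t) r (g t p))"
proof -
  obtain e' where e: "norm (p - m) = R" "norm e' = R" "(p - m) \<bullet> e' = 0"
    and eC: "\<And>z. norm z = 1 \<Longrightarrow> m + Re z *\<^sub>R (p - m) + Im z *\<^sub>R e' \<in> C"
    using circle_in_conjugate_radius [OF C p] by blast
  define E where "E = (\<lambda>t. g t p - g t m)"
  define E' where "E' = (\<lambda>t. g t (m + e') - g t m)"
  define \<mu> where "\<mu> = (\<lambda>t. g t m - c t)"
  \<comment> \<open>These coefficients come from expanding the squared distance to the hoop's centre
    on the moved circle. The squared radius contributes \<open>R\<^sup>2\<close>, by which
    \<open>\<alpha> t\<close> exceeds the value of the hoop map at the circle's centre.\<close>
  define \<alpha> where "\<alpha> = (\<lambda>t. Complex ((norm (\<mu> t))\<^sup>2 + R\<^sup>2 - r\<^sup>2) (n t \<bullet> \<mu> t))"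
  define \<beta> where "\<beta> = (\<lambda>t. Complex (2 * (E t \<bullet> \<mu> t)) (n t \<bullet> E t))"
  define \<gamma> where "\<gamma> = (\<lambda>t. Complex (2 * (E' t \<bullet> \<mu> t)) (n t \<bullet> E' t))"
  define w where "w = (\<lambda>t. hoop_map (c t) (n t) r (g t p))"
  note gD = rigid_motion_familyD [OF g]
  have contE: "continuous_on {0..1} E" "continuous_on {0..1} E'" "continuous_on {0..1} \<mu>"
    unfolding E_def E'_def \<mu>_def by (intro continuous_intros gD cont)+
  have cont\<alpha>: "continuous_on {0..1} \<alpha>" "continuous_on {0..1} \<beta>" "continuous_on {0..1} \<gamma>"
    unfolding \<alpha>_def \<beta>_def \<gamma>_def Complex_eq by (intro continuous_intros contE cont)+
  have contw: "continuous_on {0..1} w"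
    unfolding w_def by (intro continuous_intros cont gD)
  have param: "g t (m + x *\<^sub>R (p - m) + y *\<^sub>R e') = g t m + x *\<^sub>R E t + y *\<^sub>R E' t"
    and norms: "E t \<bullet> E t = R\<^sup>2" "E' t \<bullet> E' t = R\<^sup>2" "E t \<bullet> E' t = 0"
    if t: "t \<in> {0..1}" for t x y
  proof -
    obtain A where A: "orthogonal_transformation A" and gA: "\<And>x y. g t (x + y) = g t x + A y"
      using isometry_affine [of "g t"] gD(2) [OF t] by blast
    have EA: "E t = A (p - m)" "E' t = A e'"
      using gA [of m "p - m"] gA [of m e'] by (simp_all add: E_def E'_def)
    have "linear A" using A by (rule orthogonal_transformation_linear)
    then show "g t (m + x *\<^sub>R (p - m) + y *\<^sub>R e') = g t m + x *\<^sub>R E t + y *\<^sub>R E' t"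
      by (simp add: EA gA linear_cmul)
    have "A u \<bullet> A v = u \<bullet> v" for u v
      using A by (simp add: orthogonal_transformation_def)
    then show "E t \<bullet> E t = R\<^sup>2" "E' t \<bullet> E' t = R\<^sup>2" "E t \<bullet> E' t = 0"
      using e by (simp_all add: EA) (simp_all add: dot_square_norm)
  qed
  \<comment> \<open>The correction vanishes on the unit circle; inside, it compares the filled
    ellipse with the flat disc spanned by the moved circle.\<close>
  have ell: "hoop_map (c t) (n t) r (g t m + Re z *\<^sub>R E t + Im z *\<^sub>R E' t)
      = ellipse (\<alpha> t) (\<beta> t) (\<gamma> t) z - of_real (R\<^sup>2 * (1 - (norm z)\<^sup>2))"
    if t: "t \<in> {0..1}" for t z
  proof -
    have eq: "g t m + Re z *\<^sub>R E t + Im z *\<^sub>R E' t - c t = \<mu> t + Re z *\<^sub>R E t + Im z *\<^sub>R E' t"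
      by (simp add: \<mu>_def)
    have "(norm (\<mu> t + Re z *\<^sub>R E t + Im z *\<^sub>R E' t))\<^sup>2 = (norm (\<mu> t))\<^sup>2
        + Re z * (2 * (E t \<bullet> \<mu> t)) + Im z * (2 * (E' t \<bullet> \<mu> t)) + R\<^sup>2 * (norm z)\<^sup>2"
      using norms [OF t] unfolding cmod_power2 unfolding power2_norm_eq_inner
      by (simp add: inner_add_left inner_add_right inner_commute power2_eq_square algebra_simps)
    then show ?thesis
      unfolding hoop_map_def eq
      by (simp add: ellipse_def \<alpha>_def \<beta>_def \<gamma>_def complex_eq_iff inner_add_right algebra_simps)
  qed
  have in_C: "g t m + Re z *\<^sub>R E t + Im z *\<^sub>R E' t \<in> g t ` C" if "t \<in> {0..1}" "norm z = 1" for t z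
    using eC [OF that(2)] param [OF that(1)] by (metis imageI)
  have ell_C: "ellipse (\<alpha> t) (\<beta> t) (\<gamma> t) z = hoop_map (c t) (n t) r (g t m + Re z *\<^sub>R E t + Im z *\<^sub>R E' t)"
    if "t \<in> {0..1}" "norm z = 1" for t z
    using ell [OF that(1), of z] that(2) by simp
  have avoid: "ellipse (\<alpha> t) (\<beta> t) (\<gamma> t) z \<noteq> 0" if "t \<in> {0..1}" "norm z \<le> 1" for t z
  proof (rule filled_ellipse_avoids_zero [OF cont\<alpha> _ _ that])
    show "ellipse (\<alpha> t) (\<beta> t) (\<gamma> t) z \<noteq> 0" if "t \<in> {0..1}" "norm z = 1" for t z
      using nz [OF that(1) in_C [OF that]] ell_C [OF that] by simp
    show "Im (ellipse (\<alpha> 0) (\<beta> 0) (\<gamma> 0) z) \<noteq> 0" if "norm z = 1" for z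
      using init in_C [of 0 z] ell_C [of 0 z] that by (simp add: gD(1))
  qed
  \<comment> \<open>As \<open>w t\<close> has parameter \<open>1\<close>, the segment from the
    centre is the image of a radius of the unit disc.\<close>
  have segment: "\<alpha> t + l *\<^sub>R (w t - \<alpha> t) = ellipse (\<alpha> t) (\<beta> t) (\<gamma> t) (of_real l)"
    if "t \<in> {0..1}" for t l
  proof -
    have "w t = \<alpha> t + \<beta> t"
      using ell_C [OF that, of 1] by (simp add: w_def ellipse_def E_def)
    then show ?thesis by (simp add: ellipse_def)
  qed
  \<comment> \<open>The hypothesis \<open>r \<le> R\<close> gives
    \<open>Re (\<alpha> t) \<ge> 0\<close>, and \<open>\<alpha> t\<close> is nonzero as the value of
    the ellipse at \<open>0\<close>.\<close>
  have slit: "\<alpha> t \<notin> \<real>\<^sub>\<le>\<^sub>0" if "t \<in> {0..1}" for t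
  proof -
    have "\<alpha> t \<noteq> 0" using avoid [OF that, of 0] by (simp add: ellipse_def)
    moreover have "r\<^sup>2 \<le> R\<^sup>2" using r by (simp add: power_mono)
    then have "Re (\<alpha> t) \<ge> 0" by (simp add: \<alpha>_def add_increasing)
    ultimately show ?thesis
      by (auto simp: complex_nonpos_Reals_iff complex_eq_iff)
  qed
  have seg: "\<alpha> t + l *\<^sub>R (w t - \<alpha> t) \<noteq> 0" if "t \<in> {0..1}" "l \<in> {0..1}" for t l
    unfolding segment [OF that(1)] by (rule avoid) (use that in auto)
  obtain L where "continuous_on {0..1} L" "\<And>t. t \<in> {0..1} \<Longrightarrow> exp (L t) = w t"
    and Lw: "\<And>t. t \<in> {0..1} \<Longrightarrow> (\<And>l. l \<in> {0..1} \<Longrightarrow> \<alpha> t + l *\<^sub>R (w t - \<alpha> t) \<notin> \<real>\<^sub>\<le>\<^sub>0) \<Longrightarrow> L t = Ln (w t)"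
    using logarithm_along_segment [OF cont\<alpha>(1) contw slit seg] by blast
  moreover have "L t = Ln (w t)" if t: "t \<in> {0..1}"
    and hull: "\<And>y. y \<in> convex hull (g t ` C) \<Longrightarrow> hoop_map (c t) (n t) r y \<notin> \<real>\<^sub>\<le>\<^sub>0" for t
  proof (rule Lw [OF t])
    fix l :: real assume l: "l \<in> {0..1}"
    \<comment> \<open>A point of the diameter through \<open>g t p\<close>, hence a convex
      combination of two opposite points of the moved circle.\<close>
    define y where "y = g t m + l *\<^sub>R E t"
    have "g t m + E t \<in> g t ` C" "g t m - E t \<in> g t ` C"
      using in_C [OF t, of 1] in_C [OF t, of "-1"] by simp_all
    then have "((1 + l) / 2) *\<^sub>R (g t m + E t) + ((1 - l) / 2) *\<^sub>R (g t m - E t) \<in> convex hull (g t ` C)"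
      using l by (intro convexD [OF convex_convex_hull] hull_inc) (auto simp: field_simps)
    also have "((1 + l) / 2) *\<^sub>R (g t m + E t) + ((1 - l) / 2) *\<^sub>R (g t m - E t) = y"
      unfolding y_def by (simp add: vec_eq_iff field_simps)
    finally have "hoop_map (c t) (n t) r y \<notin> \<real>\<^sub>\<le>\<^sub>0" by (rule hull)
    \<comment> \<open>By \<open>ell\<close>, the ellipse exceeds the hoop map at \<open>y\<close> by
      this real number, and a shift to the right cannot enter the cut.\<close>
    moreover have "R\<^sup>2 * (1 - l\<^sup>2) \<ge> 0" using l by (simp add: power_le_one)
    ultimately have "hoop_map (c t) (n t) r y + of_real (R\<^sup>2 * (1 - l\<^sup>2)) \<notin> \<real>\<^sub>\<le>\<^sub>0"
      by (rule nonpos_Reals_add_of_real)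
    then show "\<alpha> t + l *\<^sub>R (w t - \<alpha> t) \<notin> \<real>\<^sub>\<le>\<^sub>0"
      using ell [OF t, of "of_real l"] by (simp add: segment [OF t] y_def)
  qed
  ultimately show thesis using that unfolding w_def by blast
qed

section \<open>The moved hoop, its flat disc and separation\<close>

text \<open>The vector \<open>f n - f 0\<close> is the linear part of \<open>f\<close> applied to
  \<open>n\<close>, so norm and inner product are preserved. This reduces questions about the moved
  hoop to the initial one.\<close>

lemma hoop_map_isometry:
  fixes f :: "real^3 \<Rightarrow> real^3"
  assumes "\<And>x y. dist (f x) (f y) = dist x y"
  shows "hoop_map (f c) (f n - f 0) r (f y) = hoop_map c n r y"
proof -
  obtain A where A: "orthogonal_transformation A" and fA: "\<And>x y. f (x + y) = f x + A y"
    using isometry_affine assms by blast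
  have "f n - f 0 = A n" "f y - f c = A (y - c)"
    using fA [of 0 n] fA [of c "y - c"] by simp_all
  then show ?thesis
    using A by (simp add: hoop_map_def orthogonal_transformation_def orthogonal_transformation_norm)
qed

lemma isometry_surj:
  fixes f :: "'a::euclidean_space \<Rightarrow> 'a"
  assumes "\<And>x y. dist (f x) (f y) = dist x y"
  shows "surj f"
proof -
  obtain A where A: "orthogonal_transformation A" and fA: "\<And>x y. f (x + y) = f x + A y"
    using isometry_affine assms by blast
  have "f (0 + inv A (x - f 0)) = x" for x
    unfolding fA using A by (simp add: orthogonal_transformation_surj surj_f_inv_f)
  then show ?thesis by (rule surjI)
qed

lemma hoop_map_eq_0_imp_mem:
  fixes f :: "real^3 \<Rightarrow> real^3"
  assumes f: "\<And>x y. dist (f x) (f y) = dist x y" and "r > 0" and "n \<bullet> c = d"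
    and x: "hoop_map (f c) (f n - f 0) r x = 0"
  shows "x \<in> f ` ({x. n \<bullet> x = d} \<inter> sphere c r)"
proof -
  obtain y where y: "x = f y" using surjD [OF isometry_surj [OF f]] by blast
  have "hoop_map c n r y = 0" using x hoop_map_isometry [OF f] y by simp
  then have "n \<bullet> y = d" "(norm (y - c))\<^sup>2 = r\<^sup>2"
    using assms(3) by (auto simp: hoop_map_def complex_eq_iff inner_diff_right)
  moreover from this(2) have "norm (y - c) = r"
    using \<open>r > 0\<close> by (simp add: power2_eq_iff_nonneg)
  ultimately show ?thesis
    using y by (auto simp: dist_norm norm_minus_commute)
qed

text \<open>The value places \<open>y\<close> in the closed flat disc, and a diameter through
  \<open>y\<close> exhibits it as a convex combination of two opposite points of the circle.\<close>

lemma hoop_map_nonpos_imp_hull: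
  assumes "r > 0" and "n \<bullet> c = d" and y: "hoop_map c n r y \<in> \<real>\<^sub>\<le>\<^sub>0"
  shows "y \<in> convex hull ({x. n \<bullet> x = d} \<inter> sphere c r)"
proof -
  have o: "n \<bullet> (y - c) = 0" and "(norm (y - c))\<^sup>2 \<le> r\<^sup>2"
    using y by (auto simp: hoop_map_def complex_nonpos_Reals_iff)
  then have le: "norm (y - c) \<le> r" using \<open>r > 0\<close> by (simp add: power2_le_iff_abs_le)
  obtain e where e: "norm e = 1" "n \<bullet> e = 0" and ye: "y - c = norm (y - c) *\<^sub>R e"
  proof (cases "y = c")
    case True
    \<comment> \<open>The centre singles out no direction; any unit vector orthogonal to
      \<open>n\<close> serves.\<close>
    have "dim {n} < DIM(real^3)" by simp
    then obtain x where "x \<noteq> 0" "orthogonal x n"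
      using orthogonal_to_subspace_exists [of "{n}"] by (metis insertI1 span_base)
    then show thesis
      using that [of "sgn x"] True by (simp add: norm_sgn sgn_div_norm orthogonal_def inner_commute)
  next
    case False
    then show thesis
      using that [of "sgn (y - c)"] o by (simp add: norm_sgn sgn_div_norm)
  qed
  define k where "k = norm (y - c) / r"
  have k: "0 \<le> k" "k \<le> 1" "norm (y - c) = k * r" using le \<open>r > 0\<close> by (auto simp: k_def)
  have "c + r *\<^sub>R e \<in> {x. n \<bullet> x = d} \<inter> sphere c r" "c - r *\<^sub>R e \<in> {x. n \<bullet> x = d} \<inter> sphere c r"
    using e \<open>r > 0\<close> assms(2) by (auto simp: inner_add_right inner_diff_right dist_norm)
  then have "((1 + k) / 2) *\<^sub>R (c + r *\<^sub>R e) + ((1 - k) / 2) *\<^sub>R (c - r *\<^sub>R e)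
      \<in> convex hull ({x. n \<bullet> x = d} \<inter> sphere c r)"
    using k by (intro convexD [OF convex_convex_hull] hull_inc) (auto simp: field_simps)
  also have "((1 + k) / 2) *\<^sub>R (c + r *\<^sub>R e) + ((1 - k) / 2) *\<^sub>R (c - r *\<^sub>R e) = c + (k * r) *\<^sub>R e"
    by (simp add: vec_eq_iff field_simps)
  also have "\<dots> = y" using ye unfolding k(3) by (simp add: algebra_simps)
  finally show ?thesis .
qed

text \<open>A value on the cut would put \<open>x\<close> in the convex hull of the moved hoop,
  which stays in the open half-space containing the hoop.\<close>

lemma hoop_map_slit_of_separated:
  fixes f :: "real^3 \<Rightarrow> real^3"
  assumes f: "\<And>x y. dist (f x) (f y) = dist x y" and "r > 0" and "n \<bullet> c = d"
    and sep: "f ` ({x. n \<bullet> x = d} \<inter> sphere c r) \<subseteq> {x. a \<bullet> x < b}" and x: "a \<bullet> x > b"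
  shows "hoop_map (f c) (f n - f 0) r x \<notin> \<real>\<^sub>\<le>\<^sub>0"
proof
  define h where "h = {x. n \<bullet> x = d} \<inter> sphere c r"
  assume *: "hoop_map (f c) (f n - f 0) r x \<in> \<real>\<^sub>\<le>\<^sub>0"
  obtain y where y: "x = f y" using surjD [OF isometry_surj [OF f]] by blast
  have "hoop_map c n r y \<in> \<real>\<^sub>\<le>\<^sub>0" using * hoop_map_isometry [OF f] y by simp
  then have yh: "y \<in> convex hull h"
    unfolding h_def by (rule hoop_map_nonpos_imp_hull [OF assms(2,3)])
  obtain A where A: "orthogonal_transformation A" and fA: "\<And>x y. f (x + y) = f x + A y"
    using isometry_affine f by blast
  have "h \<subseteq> A -` {v. a \<bullet> v < b - a \<bullet> f 0}"
  proof
    fix v assume "v \<in> h"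
    then have "f v \<in> {x. a \<bullet> x < b}" using sep unfolding h_def by blast
    then show "v \<in> A -` {v. a \<bullet> v < b - a \<bullet> f 0}"
      using fA [of 0 v] by (simp add: inner_add_right)
  qed
  then have "convex hull h \<subseteq> A -` {v. a \<bullet> v < b - a \<bullet> f 0}"
    by (intro hull_minimal convex_linear_vimage orthogonal_transformation_linear A convex_halfspace_lt)
  with yh have "a \<bullet> A y < b - a \<bullet> f 0" by blast
  then show False using x fA [of 0 y] y by (simp add: inner_add_right)
qed

section \<open>Applying the logarithm obstruction to the puzzle\<close>

theorem theorem2p1:
  fixes r R1 R2 :: real
    and h C1 C2 :: "(real^3) set"
    and \<rho> :: "real \<Rightarrow> real^3"
    and p1 p2 :: "real^3"
  assumes "r > 0" and "R1 > 0" and "R2 > 0"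
    and "R1 \<ge> r" and "R2 \<ge> r"
    and "initial_configuration r R1 R2 h C1 C2 \<rho>"
    and "p1 = \<rho> 0" and "p2 = \<rho> 1"
  shows "\<not> (\<exists>f g1 g2 :: real \<Rightarrow> real^3 \<Rightarrow> real^3. \<exists>\<rho>' :: real \<Rightarrow> real \<Rightarrow> real^3.
           rigid_motion_family f \<and> rigid_motion_family g1 \<and> rigid_motion_family g2 \<and>
           continuous_on ({0..1} \<times> {0..1}) (\<lambda>(t, s). \<rho>' t s) \<and>
           (\<forall>s\<in>{0..1}. \<rho>' 0 s = \<rho> s) \<and>
           (\<forall>t\<in>{0..1}. \<rho>' t 0 = g1 t p1 \<and> \<rho>' t 1 = g2 t p2) \<and>
           (\<forall>t\<in>{0..1}. f t ` h \<inter> (g1 t ` C1 \<union> g2 t ` C2 \<union> \<rho>' t ` {0..1}) = {}) \<and>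
           (\<exists>Q. opposite_sides Q (f 1 ` h) (g1 1 ` C1 \<union> g2 1 ` C2 \<union> \<rho>' 1 ` {0..1})))"
proof
  assume "\<exists>f g1 g2 :: real \<Rightarrow> real^3 \<Rightarrow> real^3. \<exists>\<rho>' :: real \<Rightarrow> real \<Rightarrow> real^3.
           rigid_motion_family f \<and> rigid_motion_family g1 \<and> rigid_motion_family g2 \<and>
           continuous_on ({0..1} \<times> {0..1}) (\<lambda>(t, s). \<rho>' t s) \<and>
           (\<forall>s\<in>{0..1}. \<rho>' 0 s = \<rho> s) \<and>
           (\<forall>t\<in>{0..1}. \<rho>' t 0 = g1 t p1 \<and> \<rho>' t 1 = g2 t p2) \<and>
           (\<forall>t\<in>{0..1}. f t ` h \<inter> (g1 t ` C1 \<union> g2 t ` C2 \<union> \<rho>' t ` {0..1}) = {}) \<and>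
           (\<exists>Q. opposite_sides Q (f 1 ` h) (g1 1 ` C1 \<union> g2 1 ` C2 \<union> \<rho>' 1 ` {0..1}))"
  then obtain f g1 g2 and \<rho>' :: "real \<Rightarrow> real \<Rightarrow> real^3" and Q where
    f: "rigid_motion_family f" and g1: "rigid_motion_family g1" and g2: "rigid_motion_family g2"
    and cont\<rho>': "continuous_on ({0..1} \<times> {0..1}) (\<lambda>(t, s). \<rho>' t s)"
    and \<rho>'0: "\<And>s. s \<in> {0..1} \<Longrightarrow> \<rho>' 0 s = \<rho> s"
    and \<rho>'1: "\<And>t. t \<in> {0..1} \<Longrightarrow> \<rho>' t 0 = g1 t p1" "\<And>t. t \<in> {0..1} \<Longrightarrow> \<rho>' t 1 = g2 t p2"
    and disj: "\<And>t. t \<in> {0..1} \<Longrightarrow> f t ` h \<inter> (g1 t ` C1 \<union> g2 t ` C2 \<union> \<rho>' t ` {0..1}) = {}"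
    and Q: "opposite_sides Q (f 1 ` h) (g1 1 ` C1 \<union> g2 1 ` C2 \<union> \<rho>' 1 ` {0..1})"
    by auto
  obtain a b where sep: "f 1 ` h \<subseteq> {x. a \<bullet> x < b}"
    "g1 1 ` C1 \<subseteq> {x. a \<bullet> x > b}" "g2 1 ` C2 \<subseteq> {x. a \<bullet> x > b}" "\<rho>' 1 ` {0..1} \<subseteq> {x. a \<bullet> x > b}"
    using Q unfolding opposite_sides_def by auto
  from assms(6) obtain Q1 m1 Q2 m2 P c s
    where C1: "circle_in Q1 m1 R1 C1" and C2: "circle_in Q2 m2 R2 C2" and path: "path \<rho>"
      and p: "p1 \<in> C1" "p2 \<in> C2" and h: "circle_in P c r h" and P: "opposite_sides P C1 C2"
      and s: "s \<in> {0..1}" and meet: "{u \<in> {0..1}. \<rho> u \<in> P} = {s}" and \<rho>s: "\<rho> s \<in> P \<inter> ball c r"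
    unfolding initial_configuration_def round_circle_def assms(7,8) pathstart_def pathfinish_def
    by blast
  obtain n d where Pn: "P = {x. n \<bullet> x = d}" and sides: "C1 \<subseteq> {x. n \<bullet> x > d}" "C2 \<subseteq> {x. n \<bullet> x < d}"
  proof -
    obtain n d where "P = {x. n \<bullet> x = d}" "C1 \<subseteq> {x. n \<bullet> x < d}" "C2 \<subseteq> {x. n \<bullet> x > d}"
      using P unfolding opposite_sides_def by auto
    \<comment> \<open>Reversing the normal makes the rope start on the positive side, so that it
      crosses downwards as \<open>no_homotopy_across_cut\<close> expects.\<close>
    then show thesis using that [of "- n" "- d"] by auto
  qed
  have nc: "n \<bullet> c = d" and h_eq: "h = {x. n \<bullet> x = d} \<inter> sphere c r"
    using h by (auto simp: circle_in_def Pn)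
  note fD = rigid_motion_familyD [OF f]
  define W where "W = (\<lambda>t. hoop_map (f t c) (f t n - f t 0) r)"
  have contc: "continuous_on {0..1} (\<lambda>t. f t c)" "continuous_on {0..1} (\<lambda>t. f t n - f t 0)"
    by (intro continuous_intros fD)+
  have W0: "W 0 x = Complex ((norm (x - c))\<^sup>2 - r\<^sup>2) (n \<bullet> x - d)" for x
    by (simp add: W_def fD(1) hoop_map_def inner_diff_right nc)
  have Wnz: "W t x \<noteq> 0" if t: "t \<in> {0..1}" and x: "x \<in> g1 t ` C1 \<union> g2 t ` C2 \<union> \<rho>' t ` {0..1}" for t x
    using hoop_map_eq_0_imp_mem [OF fD(2) [OF t] \<open>r > 0\<close> nc, of x] disj [OF t] x
    unfolding W_def h_eq by blast
  have W1: "W 1 x \<notin> \<real>\<^sub>\<le>\<^sub>0" if "a \<bullet> x > b" for x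
    unfolding W_def
    by (rule hoop_map_slit_of_separated [OF fD(2) \<open>r > 0\<close> nc _ that]) (use sep h_eq in auto)
  \<comment> \<open>This provides the hull condition under which \<open>L1 1\<close> and
    \<open>L2 1\<close> are principal logarithms.\<close>
  have hull1: "W 1 y \<notin> \<real>\<^sub>\<le>\<^sub>0" if "y \<in> convex hull X" "X \<subseteq> {x. a \<bullet> x > b}" for y X
    using W1 hull_minimal [OF that(2), of convex] that(1) convex_halfspace_gt by blast
  have slit0: "W 0 y \<notin> \<real>\<^sub>\<le>\<^sub>0" if "n \<bullet> y \<noteq> d" for y
    using that by (auto simp: W0 complex_nonpos_Reals_iff)
  obtain L1 where L1: "continuous_on {0..1} L1" "\<And>t. t \<in> {0..1} \<Longrightarrow> exp (L1 t) = W t (g1 t p1)"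
    "\<And>t. t \<in> {0..1} \<Longrightarrow> (\<And>y. y \<in> convex hull (g1 t ` C1) \<Longrightarrow> W t y \<notin> \<real>\<^sub>\<le>\<^sub>0) \<Longrightarrow> L1 t = Ln (W t (g1 t p1))"
  proof (rule hoop_map_circle_logarithm [OF C1 p(1) _ \<open>R1 \<ge> r\<close> g1 contc])
    show "hoop_map (f t c) (f t n - f t 0) r x \<noteq> 0" if "t \<in> {0..1}" "x \<in> g1 t ` C1" for t x
      using Wnz [OF that(1), of x] that(2) by (simp add: W_def)
    show "Im (hoop_map (f 0 c) (f 0 n - f 0 0) r x) \<noteq> 0" if "x \<in> C1" for x
      using W0 [of x] that sides by (auto simp: W_def)
  qed (use \<open>r > 0\<close> that in \<open>auto simp: W_def\<close>)
  obtain L2 where L2: "continuous_on {0..1} L2" "\<And>t. t \<in> {0..1} \<Longrightarrow> exp (L2 t) = W t (g2 t p2)"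
    "\<And>t. t \<in> {0..1} \<Longrightarrow> (\<And>y. y \<in> convex hull (g2 t ` C2) \<Longrightarrow> W t y \<notin> \<real>\<^sub>\<le>\<^sub>0) \<Longrightarrow> L2 t = Ln (W t (g2 t p2))"
  proof (rule hoop_map_circle_logarithm [OF C2 p(2) _ \<open>R2 \<ge> r\<close> g2 contc])
    show "hoop_map (f t c) (f t n - f t 0) r x \<noteq> 0" if "t \<in> {0..1}" "x \<in> g2 t ` C2" for t x
      using Wnz [OF that(1), of x] that(2) by (simp add: W_def)
    show "Im (hoop_map (f 0 c) (f 0 n - f 0 0) r x) \<noteq> 0" if "x \<in> C2" for x
      using W0 [of x] that sides by (auto simp: W_def)
  qed (use \<open>r > 0\<close> that in \<open>auto simp: W_def\<close>)
  have "n \<bullet> \<rho> 0 > d" "n \<bullet> \<rho> 1 < d" using p sides assms(7,8) by auto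
  have on_P: "u = s" if "u \<in> {0..1}" "n \<bullet> \<rho> u = d" for u
    using meet that unfolding Pn by blast
  have cont\<rho>: "continuous_on {0..1} (\<lambda>u. n \<bullet> \<rho> u)"
    using path unfolding path_def by (intro continuous_intros)
  \<comment> \<open>By the intermediate value theorem, a failure would yield a second parameter at
    which the rope meets the plane.\<close>
  have up: "n \<bullet> \<rho> u > d" if "0 \<le> u" "u < s" for u
  proof (rule ccontr)
    assume "\<not> n \<bullet> \<rho> u > d"
    then have "\<exists>v\<ge>0. v \<le> u \<and> n \<bullet> \<rho> v = d"
      using that s \<open>n \<bullet> \<rho> 0 > d\<close> by (intro IVT2' continuous_on_subset [OF cont\<rho>]) auto
    then obtain v where "0 \<le> v" "v \<le> u" "n \<bullet> \<rho> v = d" by blast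
    then show False using on_P [of v] that s by simp
  qed
  have down: "n \<bullet> \<rho> u < d" if "s < u" "u \<le> 1" for u
  proof (rule ccontr)
    assume "\<not> n \<bullet> \<rho> u < d"
    then have "\<exists>v\<ge>u. v \<le> 1 \<and> n \<bullet> \<rho> v = d"
      using that s \<open>n \<bullet> \<rho> 1 < d\<close> by (intro IVT2' continuous_on_subset [OF cont\<rho>]) auto
    then obtain v where "u \<le> v" "v \<le> 1" "n \<bullet> \<rho> v = d" by blast
    then show False using on_P [of v] that s by simp
  qed
  \<comment> \<open>The hulls of the end circles stay strictly on their sides of the hoop's plane,
    so by \<open>slit0\<close> the logarithms at time \<open>0\<close> are principal too.\<close>
  have hull0: "n \<bullet> y \<noteq> d" if "y \<in> convex hull C1 \<or> y \<in> convex hull C2" for y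
    using that hull_minimal [of C1 _ convex, OF sides(1)] hull_minimal [of C2 _ convex, OF sides(2)]
      convex_halfspace_gt [of d n] convex_halfspace_lt [of n d] by auto
  show False
  proof (rule no_homotopy_across_cut [where w = "\<lambda>t u. W t (\<rho>' t u)" and s = s, OF _ _ L1(1) L2(1)])
    have cont_fst: "continuous_on ({0..1} \<times> {0..1::real}) (\<lambda>x. k (fst x))"
      if "continuous_on {0..1} k" for k :: "real \<Rightarrow> real^3"
      by (rule continuous_on_compose2 [OF that]) (auto intro: continuous_on_fst continuous_on_id)
    show "continuous_on ({0..1} \<times> {0..1}) (\<lambda>(t, u). W t (\<rho>' t u))"
      using cont\<rho>' unfolding W_def case_prod_beta
      by (intro continuous_intros cont_fst fD)
    show "W t (\<rho>' t u) \<noteq> 0" if "t \<in> {0..1}" "u \<in> {0..1}" for t u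
      using Wnz that by blast
    show "exp (L1 t) = W t (\<rho>' t 0)" "exp (L2 t) = W t (\<rho>' t 1)" if "t \<in> {0..1}" for t
      using that by (simp_all add: L1 L2 \<rho>'1)
    show "L1 0 = Ln (W 0 (\<rho>' 0 0))" "L2 0 = Ln (W 0 (\<rho>' 0 1))"
      using L1(3) [of 0] L2(3) [of 0] hull0 slit0 rigid_motion_familyD(1) [OF g1]
        rigid_motion_familyD(1) [OF g2] by (simp_all add: \<rho>'1)
    show "L1 1 = Ln (W 1 (\<rho>' 1 0))" "L2 1 = Ln (W 1 (\<rho>' 1 1))"
      using L1(3) [of 1] L2(3) [of 1] hull1 sep by (simp_all add: \<rho>'1)
    show "W 1 (\<rho>' 1 u) \<notin> \<real>\<^sub>\<le>\<^sub>0" if "u \<in> {0..1}" for u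
      using W1 sep(4) that by blast
    show "Im (W 0 (\<rho>' 0 u)) > 0" if "0 \<le> u" "u < s" for u
      using up [OF that] s that by (simp add: W0 \<rho>'0)
    show "Im (W 0 (\<rho>' 0 u)) < 0" if "s < u" "u \<le> 1" for u
      using down [OF that] s that by (simp add: W0 \<rho>'0)
    have "n \<bullet> \<rho> s = d" "norm (\<rho> s - c) < r"
      using \<rho>s by (auto simp: Pn dist_norm norm_minus_commute)
    then show "Im (W 0 (\<rho>' 0 s)) = 0" "Re (W 0 (\<rho>' 0 s)) < 0"
      using s by (simp_all add: W0 \<rho>'0 power_strict_mono)
    show "Im (W 0 (\<rho>' 0 0)) > 0" "Im (W 0 (\<rho>' 0 1)) < 0"
      using \<open>n \<bullet> \<rho> 0 > d\<close> \<open>n \<bullet> \<rho> 1 < d\<close> by (simp_all add: W0 \<rho>'0)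
  qed (rule s)
qed

end
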